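(* Let $X$ be a metric space, $\Omega \subset X$, and let $F \colon \Omega \times [a,b) \times [a,b) \rightarrow X$ satisfy $F(x,\tau,\tau)=x$ for all $x \in \Omega$, $\tau \in [a,b)$. Assume the following: 1. For every $x,y \in \Omega$ and $\tau \in (a,b)$, $$\liminf_{t \to \tau_-} \Big( |F(x,\tau,t)-F(y,\tau,t)| - |x-y| \Big) \geq 0.$$ 2. There exist an increasing function $\xi \colon [a,b) \rightarrow \mathbb{R}$ and an Osgood type modulus function $\omega \colon \mathbb{R}^+_0 \rightarrow \mathbb{R}^+_0$ such that for every $x,y \in \Omega$ and $\tau \in (a,b)$, $$\liminf_{t \to \tau_+} \frac{|F(x,\tau,t)-F(y,\tau,t)| - |x-y|}{\xi(t)-\xi(\tau)} \leq \omega(|x-y|).$$ Then every solution of $\dot{x} = \mathrm{D}_t\, F(x,\tau,t)$ on $[a,b)$ is locally unique in the future (at every point $(u(\tau),\tau)$, $\tau \in [a,b)$, of such a solution $u$).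
   Context: $|x-y|$ denotes the distance between points $x,y$ of the metric space $X$. $\mathbb{R}^+$ is the set of positive reals and $\mathbb{R}^+_0$ the set of nonnegative reals. "Increasing" means strictly increasing. Modulus functions: $\omega \colon \mathbb{R}^+_0 \to \mathbb{R}^+_0$ is a modulus function if it is continuous, nondecreasing, $\omega(0)=0$ and $\omega(\nu)>0$ for $\nu>0$. It is an Osgood type modulus function if moreover for every $\nu>0$, $\lim_{r\to 0_+}\int_r^\nu \frac{1}{\omega(s)}\,\mathrm{d}s = +\infty$. Partitions: a partition of $[\alpha,\beta]$ is a collection $\{[t_{i-1},t_i],\tau_i\}_{i=1}^k$ of consecutive closed intervals with tags such that $t_0=\alpha$, $t_k=\beta$, $\tau_i \in [t_{i-1},t_i]$. For $\delta \colon [\alpha,\beta]\to\mathbb{R}^+$ it is $\delta$-fine if $[t_{i-1},t_i]\subset(\tau_i-\delta(\tau_i),\tau_i+\delta(\tau_i))$ for every $i$. Solutions: let $I\subset\mathbb{R}$ be an interval and let $F$ (with values in $X$, satisfying $F(x,\tau,\tau)=x$) be defined on $\Omega\times I\times I$ (or restricted to it). A function $u\colon I\to X$ is a solution of $\dot{x}=\mathrm{D}_t\,F(x,\tau,t)$ on $I$ if $u(\tau)\in\Omega$ for all $\tau\in I$ and the constant zero is an indefinite strong Henstock-Kurzweil integral of $U(\tau,t)=|u(t)-F(u(\tau),\tau,t)|$ on $I$, i.e. for every $\varepsilon>0$ and every $[\alpha,\beta]\subset I$ there exists $\delta\colon[\alpha,\beta]\to\mathbb{R}^+$ such that every $\delta$-fine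 partition $\{[t_{i-1},t_i],\tau_i\}_{i=1}^k$ of $[\alpha,\beta]$ satisfies $$\sum_{i=1}^k \Big|\,|u(t_i)-F(u(\tau_i),\tau_i,t_i)| - |u(t_{i-1})-F(u(\tau_i),\tau_i,t_{i-1})|\,\Big|<\varepsilon.$$ Local uniqueness: let $u\colon I\to X$ be a solution of $\dot{x}=\mathrm{D}_t\,F(x,\tau,t)$ on $[\tau,\tau+\delta]\subset I$ (for some $\delta>0$) with $u(\tau)=x_\tau$. Then $u$ is locally unique in the future at $(x_\tau,\tau)$ if for any $v\colon I\to X$ that is a solution on $[\tau,\tau+\eta]$ for some $\eta>0$ and satisfies $v(\tau)=x_\tau$, there exists $\zeta>0$ such that $v(t)=u(t)$ for $t\in[\tau,\tau+\zeta]$. *)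

theory Defs
  imports "HOL-Analysis.Analysis"
begin

definition modulus_function :: "(real \<Rightarrow> real) \<Rightarrow> bool" where
  "modulus_function \<omega> \<longleftrightarrow>
     continuous_on {0..} \<omega> \<and> mono_on {0..} \<omega> \<and> \<omega> 0 = 0 \<and> (\<forall>\<nu>>0. \<omega> \<nu> > 0)"

definition Osgood_modulus_function :: "(real \<Rightarrow> real) \<Rightarrow> bool" where
  "Osgood_modulus_function \<omega> \<longleftrightarrow>
     modulus_function \<omega> \<and>
     (\<forall>\<nu>>0. filterlim (\<lambda>r. integral {r..\<nu>} (\<lambda>s. 1 / \<omega> s)) at_top (at_right 0))"

text \<open>
  The partition points are \<open>t 0, \<dots>, t k\<close> and the tags are \<open>\<tau> 1, \<dots>, \<tau> k\<close>; all other values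
  of \<open>t\<close> and \<open>\<tau>\<close> are irrelevant.  Subintervals are nondegenerate; a degenerate one would
  contribute zero to the sums below.
\<close>

definition tagged_partition ::
  "real \<Rightarrow> real \<Rightarrow> nat \<Rightarrow> (nat \<Rightarrow> real) \<Rightarrow> (nat \<Rightarrow> real) \<Rightarrow> bool" where
  "tagged_partition \<alpha> \<beta> k t \<tau> \<longleftrightarrow>
     t 0 = \<alpha> \<and> t k = \<beta> \<and> (\<forall>i\<in>{1..k}. t (i - 1) < t i \<and> \<tau> i \<in> {t (i - 1)..t i})"

definition fine_partition ::
  "(real \<Rightarrow> real) \<Rightarrow> nat \<Rightarrow> (nat \<Rightarrow> real) \<Rightarrow> (nat \<Rightarrow> real) \<Rightarrow> bool" where
  "fine_partition \<delta> k t \<tau> \<longleftrightarrow>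
     (\<forall>i\<in>{1..k}. {t (i - 1)..t i} \<subseteq> {\<tau> i - \<delta> (\<tau> i)<..<\<tau> i + \<delta> (\<tau> i)})"

text \<open>The constant zero is an indefinite strong Henstock-Kurzweil integral of \<open>U\<close> on \<open>I\<close>.\<close>

definition zero_strong_HK_integral :: "(real \<Rightarrow> real \<Rightarrow> real) \<Rightarrow> real set \<Rightarrow> bool" where
  "zero_strong_HK_integral U I \<longleftrightarrow>
     (\<forall>\<epsilon>>0. \<forall>\<alpha> \<beta>. \<alpha> \<le> \<beta> \<and> {\<alpha>..\<beta>} \<subseteq> I \<longrightarrow>
       (\<exists>\<delta>. (\<forall>s\<in>{\<alpha>..\<beta>}. \<delta> s > 0) \<and>
         (\<forall>k t \<tau>. tagged_partition \<alpha> \<beta> k t \<tau> \<and> fine_partition \<delta> k t \<tau> \<longrightarrow>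
           (\<Sum>i=1..k. \<bar>U (\<tau> i) (t i) - U (\<tau> i) (t (i - 1))\<bar>) < \<epsilon>)))"

text \<open>
  \<open>u\<close> solves the generalized equation \<open>x' = D\<^sub>t F(x,\<tau>,t)\<close> on the interval \<open>I\<close>.
  Only the values of \<open>F\<close> on \<open>\<Omega> \<times> I \<times> I\<close> and of \<open>u\<close> on \<open>I\<close> matter.
\<close>

definition solution_on ::
  "'a set \<Rightarrow> ('a \<Rightarrow> real \<Rightarrow> real \<Rightarrow> 'a::metric_space) \<Rightarrow> real set \<Rightarrow> (real \<Rightarrow> 'a) \<Rightarrow> bool" where
  "solution_on \<Omega> F I u \<longleftrightarrow>
     (\<forall>\<tau>\<in>I. u \<tau> \<in> \<Omega>) \<and>
     zero_strong_HK_integral (\<lambda>\<tau> t. dist (u t) (F (u \<tau>) \<tau> t)) I"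

text \<open>
  Functions \<open>I \<rightarrow> X\<close> are modelled as total functions, so the intervals on which solutions are
  considered or compared are explicitly required to lie in \<open>I\<close>.
\<close>

definition locally_unique_in_future ::
  "'a set \<Rightarrow> ('a \<Rightarrow> real \<Rightarrow> real \<Rightarrow> 'a::metric_space) \<Rightarrow> real set \<Rightarrow> (real \<Rightarrow> 'a) \<Rightarrow> 'a \<Rightarrow> real \<Rightarrow> bool" where
  "locally_unique_in_future \<Omega> F I u x \<tau> \<longleftrightarrow>
     (\<exists>\<delta>>0. {\<tau>..\<tau> + \<delta>} \<subseteq> I \<and> solution_on \<Omega> F {\<tau>..\<tau> + \<delta>} u) \<and> u \<tau> = x \<and>
     (\<forall>v. (\<exists>\<eta>>0. {\<tau>..\<tau> + \<eta>} \<subseteq> I \<and> solution_on \<Omega> F {\<tau>..\<tau> + \<eta>} v) \<and> v \<tau> = x \<longrightarrow>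
       (\<exists>\<zeta>>0. {\<tau>..\<tau> + \<zeta>} \<subseteq> I \<and> (\<forall>t\<in>{\<tau>..\<tau> + \<zeta>}. v t = u t)))"

end

theory Submission imports Defs begin

text \<open>
  For two solutions \<open>u, v\<close> with the same initial value put \<open>g(t) = |u(t) - v(t)|\<close>. If \<open>g(t) > 0\<close> at
  some later \<open>t\<close>, then for small \<open>r > 0\<close> let \<open>p\<close> be the supremum of the earlier times where \<open>g \<le> r\<close>.
  The left condition makes \<open>g\<close> lower semicontinuous from the left, so \<open>g(p) \<le> r\<close>, and \<open>g(p) > 0\<close>
  since \<open>g\<close> is right-continuous at its zeros; hence \<open>g \<ge> g(p) > 0\<close> on \<open>[p, t]\<close>. There the concave
  function \<open>\<integral> 1/\<omega>\<close> of \<open>g\<close> grows at most as fast as \<open>\<xi>\<close>, even across jumps of \<open>\<xi>\<close>, so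
  the integral of \<open>1/\<omega>\<close> from \<open>r\<close> to \<open>g(t)\<close> is bounded independently of \<open>r\<close>, contradicting the Osgood condition.
\<close>

section \<open>Sums over fine partitions and their monotone majorant\<close>

text \<open>The partition data are hidden behind an existential quantifier and the right endpoint is
  a parameter, so that partitions can be built up from left to right one interval at a time.\<close>

definition fine_sum ::
  "(real \<Rightarrow> real \<Rightarrow> real) \<Rightarrow> (real \<Rightarrow> real) \<Rightarrow> real \<Rightarrow> real \<Rightarrow> real \<Rightarrow> bool" where
  "fine_sum U \<delta> \<alpha> \<beta> s \<longleftrightarrow>
     (\<exists>k t \<tau>. tagged_partition \<alpha> \<beta> k t \<tau> \<and> fine_partition \<delta> k t \<tau> \<and>
       s = (\<Sum>i=1..k. \<bar>U (\<tau> i) (t i) - U (\<tau> i) (t (i - 1))\<bar>))"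

lemma fine_sum_refl: "fine_sum U \<delta> \<alpha> \<alpha> 0"
  unfolding fine_sum_def tagged_partition_def fine_partition_def
  by (rule exI[of _ 0]) auto

lemma fine_sum_snoc:
  assumes "fine_sum U \<delta> \<alpha> x s" "x < y" "c \<in> {x..y}" "{x..y} \<subseteq> {c - \<delta> c<..<c + \<delta> c}"
  shows "fine_sum U \<delta> \<alpha> y (s + \<bar>U c y - U c x\<bar>)"
proof -
  obtain k t \<tau> where tp: "tagged_partition \<alpha> x k t \<tau>" and fp: "fine_partition \<delta> k t \<tau>"
    and s: "s = (\<Sum>i=1..k. \<bar>U (\<tau> i) (t i) - U (\<tau> i) (t (i - 1))\<bar>)"
    using assms(1) unfolding fine_sum_def by blast
  define t' \<tau>' where "t' = t(Suc k := y)" and "\<tau>' = \<tau>(Suc k := c)"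
  have old: "t' i = t i" "t' (i - 1) = t (i - 1)" "\<tau>' i = \<tau> i" if "i \<in> {1..k}" for i
    using that by (auto simp: t'_def \<tau>'_def)
  have new: "t' (Suc k) = y" "t' k = x" "\<tau>' (Suc k) = c"
    using tp by (auto simp: t'_def \<tau>'_def tagged_partition_def)
  have ivl: "{1..Suc k} = insert (Suc k) {1..k}" by auto
  have "tagged_partition \<alpha> y (Suc k) t' \<tau>'"
    unfolding tagged_partition_def ivl
    using tp assms(2,3) new old by (auto simp: tagged_partition_def t'_def)
  moreover have "fine_partition \<delta> (Suc k) t' \<tau>'"
    unfolding fine_partition_def ivl
  proof
    fix i assume "i \<in> insert (Suc k) {1..k}"
    then consider "i = Suc k" | "i \<in> {1..k}" by blast
    then show "{t' (i - 1)..t' i} \<subseteq> {\<tau>' i - \<delta> (\<tau>' i)<..<\<tau>' i + \<delta> (\<tau>' i)}"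
    proof cases
      case 1
      then show ?thesis using assms(4) new by simp
    next
      case 2
      then show ?thesis using fp unfolding fine_partition_def by (simp only: old[OF 2])
    qed
  qed
  moreover have "s + \<bar>U c y - U c x\<bar> =
      (\<Sum>i=1..Suc k. \<bar>U (\<tau>' i) (t' i) - U (\<tau>' i) (t' (i - 1))\<bar>)"
  proof -
    have "(\<Sum>i=1..k. \<bar>U (\<tau>' i) (t' i) - U (\<tau>' i) (t' (i - 1))\<bar>) = s"
      unfolding s by (rule sum.cong) (simp_all only: old)
    then show ?thesis by (simp add: new)
  qed
  ultimately show ?thesis
    unfolding fine_sum_def by blast
qed

text \<open>This is Cousin's lemma in a form that keeps track of the sums. The property "every sum
  at the left end is dominated by some sum at the right end" is transitive in adjacent intervals and
  holds on short intervals around each \<open>z\<close>, where \<open>z\<close> serves as the tag.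
  Appended terms are nonnegative, so sums only grow.\<close>

lemma fine_sum_extend:
  assumes "fine_sum U \<delta> \<alpha> x s" "x \<le> y" "\<And>z. z \<in> {x..y} \<Longrightarrow> \<delta> z > 0"
  shows "\<exists>s'\<ge>s. fine_sum U \<delta> \<alpha> y s'"
proof -
  have "\<forall>s. fine_sum U \<delta> \<alpha> x s \<longrightarrow> (\<exists>s'\<ge>s. fine_sum U \<delta> \<alpha> y s')"
    using assms(2)
  proof (induction rule: Bolzano)
    case (trans a b c)
    then show ?case by (meson order_trans)
  next
    case (local z)
    show ?case
    proof (rule exI[of _ "\<delta> z"], intro conjI allI impI)
      show "0 < \<delta> z" using assms(3) local by auto
      fix l r s
      assume lr: "l \<le> z \<and> z \<le> r \<and> r - l < \<delta> z" and s: "fine_sum U \<delta> \<alpha> l s"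
      show "\<exists>s'\<ge>s. fine_sum U \<delta> \<alpha> r s'"
      \<comment> \<open>Partition intervals are nondegenerate, so nothing may be appended when
        \<open>l = r\<close>.\<close>
      proof (cases "l = r")
        case True
        then show ?thesis using s by auto
      next
        case False
        have "fine_sum U \<delta> \<alpha> r (s + \<bar>U z r - U z l\<bar>)"
          using lr False by (intro fine_sum_snoc[OF s]) auto
        then show ?thesis by (intro exI[of _ "s + \<bar>U z r - U z l\<bar>"]) simp
      qed
    qed
  qed
  then show ?thesis using assms(1) by blast
qed

text \<open>The supremum of the sums over fine partitions of \<open>[\<alpha>, x]\<close>, as a function of \<open>x\<close>,
  trades the partitions for a monotone function of small total variation.\<close>

lemma zero_strong_HK_integral_majorant:
  assumes "zero_strong_HK_integral U I" "\<alpha> \<le> \<beta>" "{\<alpha>..\<beta>} \<subseteq> I" "\<epsilon> > 0"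
  obtains \<delta> V where
    "\<And>z. z \<in> {\<alpha>..\<beta>} \<Longrightarrow> \<delta> z > 0"
    "mono_on {\<alpha>..\<beta>} V" "V \<beta> - V \<alpha> \<le> \<epsilon>"
    "\<And>x y c. \<alpha> \<le> x \<Longrightarrow> x \<le> c \<Longrightarrow> c \<le> y \<Longrightarrow> y \<le> \<beta> \<Longrightarrow> c - \<delta> c < x \<Longrightarrow> y < c + \<delta> c \<Longrightarrow>
       \<bar>U c y - U c x\<bar> \<le> V y - V x"
proof -
  obtain \<delta> where \<delta>: "\<And>z. z \<in> {\<alpha>..\<beta>} \<Longrightarrow> \<delta> z > 0"
    and part: "\<And>k t \<tau>. tagged_partition \<alpha> \<beta> k t \<tau> \<Longrightarrow> fine_partition \<delta> k t \<tau> \<Longrightarrow>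
      (\<Sum>i=1..k. \<bar>U (\<tau> i) (t i) - U (\<tau> i) (t (i - 1))\<bar>) < \<epsilon>"
    using assms(1)[unfolded zero_strong_HK_integral_def, rule_format, OF assms(4) conjI[OF assms(2,3)]]
    by blast
  have sums: "s < \<epsilon>" if "fine_sum U \<delta> \<alpha> \<beta> s" for s
    using that part unfolding fine_sum_def by blast
  define S where "S x = {s. fine_sum U \<delta> \<alpha> x s}" for x
  define V where "V x = Sup (S x)" for x
  have ext: "\<exists>s'\<ge>s. s' \<in> S y" if "s \<in> S x" "\<alpha> \<le> x" "x \<le> y" "y \<le> \<beta>" for s x y
    using fine_sum_extend[of U \<delta> \<alpha> x s y] that \<delta> unfolding S_def by auto
  \<comment> \<open>The hypothesis speaks only of partitions of the whole interval; a partial one is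
    first extended to \<open>\<beta>\<close>, which does not decrease its sum.\<close>
  have bound: "s < \<epsilon>" if "s \<in> S x" "\<alpha> \<le> x" "x \<le> \<beta>" for s x
    using ext[OF that order_refl] sums unfolding S_def by force
  have zero: "0 \<in> S \<alpha>" by (simp add: S_def fine_sum_refl)
  have ne: "S x \<noteq> {}" if "\<alpha> \<le> x" "x \<le> \<beta>" for x
    using ext[OF zero order_refl that] by blast
  have bdd: "bdd_above (S x)" if "\<alpha> \<le> x" "x \<le> \<beta>" for x
    using bound that by (intro bdd_aboveI[of _ \<epsilon>]) force
  have mono: "V x \<le> V y" if "\<alpha> \<le> x" "x \<le> y" "y \<le> \<beta>" for x y
    unfolding V_def
  proof (rule cSup_mono)
    show "S x \<noteq> {}" "bdd_above (S y)" using ne[of x] bdd[of y] that by auto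
    show "\<exists>s'\<in>S y. s \<le> s'" if "s \<in> S x" for s
      using ext[OF that] \<open>\<alpha> \<le> x\<close> \<open>x \<le> y\<close> \<open>y \<le> \<beta>\<close> by blast
  qed
  have incr: "\<bar>U c y - U c x\<bar> \<le> V y - V x"
    if "\<alpha> \<le> x" "x \<le> c" "c \<le> y" "y \<le> \<beta>" "c - \<delta> c < x" "y < c + \<delta> c" for x y c
  proof (cases "x = y")
    case True
    then show ?thesis by simp
  next
    case False
    \<comment> \<open>Appending the interval from \<open>x\<close> to \<open>y\<close> with tag
      \<open>c\<close> to any fine partition ending at \<open>x\<close> raises the sum by exactly
      this term, so the supremum rises by at least as much.\<close>
    have "V x \<le> V y - \<bar>U c y - U c x\<bar>"
      unfolding V_def[of x]
    proof (rule cSup_least)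
      show "S x \<noteq> {}" using ne that by auto
      fix s assume "s \<in> S x"
      then have "s + \<bar>U c y - U c x\<bar> \<in> S y"
        unfolding S_def using that False by (auto intro!: fine_sum_snoc)
      then have "s + \<bar>U c y - U c x\<bar> \<le> V y"
        unfolding V_def using bdd that by (intro cSup_upper) auto
      then show "s \<le> V y - \<bar>U c y - U c x\<bar>" by simp
    qed
    then show ?thesis by simp
  qed
  have "0 \<le> V \<alpha>"
    unfolding V_def using zero bdd assms(2) by (intro cSup_upper) auto
  moreover have "V \<beta> \<le> \<epsilon>"
    unfolding V_def using ne bound assms(2) by (intro cSup_least) (auto intro: less_imp_le)
  ultimately show thesis
    using that[of \<delta> V, OF \<delta> _ _ incr] mono by (simp add: mono_on_def)
qed

text \<open>A single interval with \<open>c\<close> as both tag and endpoint already obeys the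
  majorant estimate, so \<open>U c t\<close> is bounded by the total increase of \<open>V\<close>,
  which is at most \<open>e / 2\<close>.\<close>

lemma zero_strong_HK_integral_tendsto:
  assumes "zero_strong_HK_integral U I" "{\<alpha>..\<beta>} \<subseteq> I" "c \<in> {\<alpha>..\<beta>}" "U c c = 0"
  shows "((\<lambda>t. U c t) \<longlongrightarrow> 0) (at c within {\<alpha>..\<beta>})"
proof (rule tendstoI)
  fix e :: real assume "e > 0"
  then have e2: "e / 2 > 0" by simp
  have ab: "\<alpha> \<le> \<beta>" using assms(3) by auto
  obtain \<delta> V where \<delta>: "\<And>z. z \<in> {\<alpha>..\<beta>} \<Longrightarrow> \<delta> z > 0"
    and V: "mono_on {\<alpha>..\<beta>} V" "V \<beta> - V \<alpha> \<le> e / 2"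
    and incr: "\<And>x y c. \<alpha> \<le> x \<Longrightarrow> x \<le> c \<Longrightarrow> c \<le> y \<Longrightarrow> y \<le> \<beta> \<Longrightarrow> c - \<delta> c < x \<Longrightarrow> y < c + \<delta> c \<Longrightarrow>
       \<bar>U c y - U c x\<bar> \<le> V y - V x"
    using zero_strong_HK_integral_majorant[OF assms(1) ab assms(2) e2] by blast
  have "\<bar>U c t\<bar> < e" if t: "t \<in> {\<alpha>..\<beta>}" "dist t c < \<delta> c" for t
  proof -
    \<comment> \<open>\<open>max\<close> and \<open>min\<close> treat the points on both sides of
      \<open>c\<close> at once.\<close>
    have "\<bar>U c (max c t) - U c (min c t)\<bar> \<le> V (max c t) - V (min c t)"
      using t assms(3) \<delta>[OF assms(3)] by (intro incr) (auto simp: dist_real_def max_def min_def)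
    also have "\<dots> \<le> V \<beta> - V \<alpha>"
      using t assms(3) by (intro diff_mono mono_onD[OF V(1)]) auto
    also have "\<dots> < e" using V(2) \<open>e > 0\<close> by simp
    finally show ?thesis using assms(4) by (auto simp: max_def min_def split: if_splits)
  qed
  then show "\<forall>\<^sub>F t in at c within {\<alpha>..\<beta>}. dist (U c t) 0 < e"
    unfolding eventually_at using \<delta>[OF assms(3)] by (intro exI[of _ "\<delta> c"]) auto
qed

section \<open>Growth estimates from one-sided local conditions\<close>

text \<open>\<open>M\<close> need not be continuous: its monotonicity alone absorbs the passage to a limit from the left.\<close>

lemma increment_le_monotone_increment:
  fixes h M :: "real \<Rightarrow> real"
  assumes "p \<le> q" and M: "mono_on {p..q} M"
    and left: "\<And>x e. x \<in> {p<..q} \<Longrightarrow> e > 0 \<Longrightarrow> eventually (\<lambda>t. h x - e < h t) (at_left x)"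
    and right: "\<And>x. x \<in> {p..<q} \<Longrightarrow> \<exists>t\<in>{x<..q}. h t - h x \<le> M t - M x"
  shows "h q - h p \<le> M q - M p"
proof -
  \<comment> \<open>Continuous induction: the left condition puts the supremum of \<open>S\<close>
    into \<open>S\<close>, and the right condition forbids it to lie before
    \<open>q\<close>.\<close>
  define S where "S = {x \<in> {p..q}. h x - h p \<le> M x - M p}"
  define z where "z = Sup S"
  have pS: "p \<in> S" using assms(1) by (simp add: S_def)
  have bdd: "bdd_above S" by (auto simp: S_def)
  have z: "p \<le> z" "z \<le> q"
    unfolding z_def using pS bdd by (auto intro: cSup_upper intro!: cSup_least simp: S_def)
  have zS: "z \<in> S"
  proof (rule ccontr)
    assume nz: "z \<notin> S"
    then have "p < z" using pS z by (cases "p = z") auto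
    have "h z - h p \<le> M z - M p + e" if "e > 0" for e
    proof -
      obtain l where l: "l < z" "\<And>t. l < t \<Longrightarrow> t < z \<Longrightarrow> h z - e < h t"
        using left[of z e] \<open>e > 0\<close> \<open>p < z\<close> z eventually_at_left[OF \<open>p < z\<close>] by auto
      obtain x where x: "x \<in> S" "l < x"
        using less_cSup_iff[OF _ bdd, of l] l(1) pS unfolding z_def by blast
      have "x \<le> z" unfolding z_def by (rule cSup_upper[OF x(1) bdd])
      then have "x < z" using nz x(1) by (metis order_le_less)
      \<comment> \<open>The estimate at \<open>x\<close> passes to \<open>z\<close> with loss
        \<open>e\<close>: \<open>h\<close> is almost as large at \<open>x\<close> as at
        \<open>z\<close>, and \<open>M\<close> is no larger at \<open>x\<close> than at
        \<open>z\<close>.\<close>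
      then have "M x \<le> M z" using x(1) z by (intro mono_onD[OF M]) (auto simp: S_def)
      moreover have "h z - e < h x" using l(2) x(2) \<open>x < z\<close> by blast
      ultimately show ?thesis using x(1) unfolding S_def by simp
    qed
    then have "h z - h p \<le> M z - M p" by (rule field_le_epsilon)
    then show False using nz z by (simp add: S_def)
  qed
  have "z = q"
  proof (rule ccontr)
    assume "z \<noteq> q"
    then obtain t where t: "t \<in> {z<..q}" "h t - h z \<le> M t - M z" using right[of z] z by auto
    then have "t \<in> S" using zS z by (auto simp: S_def)
    then have "t \<le> z" unfolding z_def by (rule cSup_upper[OF _ bdd])
    then show False using t by simp
  qed
  then show ?thesis using zS by (simp add: S_def)
qed

section \<open>Integrals of the reciprocal modulus and the comparison estimate\<close>

lemma modulus_function_integrable: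
  assumes "modulus_function \<omega>" "0 < x"
  shows "(\<lambda>s. 1 / \<omega> s) integrable_on {x..y}"
proof (rule integrable_continuous_real)
  have "continuous_on {x..y} \<omega>"
    using assms unfolding modulus_function_def by (auto elim: continuous_on_subset)
  moreover have "\<omega> s \<noteq> 0" if "s \<in> {x..y}" for s
    using assms that unfolding modulus_function_def by (metis atLeastAtMost_iff less_irrefl order_less_le_trans)
  ultimately show "continuous_on {x..y} (\<lambda>s. 1 / \<omega> s)"
    by (intro continuous_intros) auto
qed

lemma modulus_functionD:
  assumes "modulus_function \<omega>" "0 < x"
  shows "0 < \<omega> x" "x \<le> y \<Longrightarrow> \<omega> x \<le> \<omega> y"
  using assms unfolding modulus_function_def by (auto intro: mono_onD)

text \<open>Tangent line inequality for the concave function \<open>x \<mapsto> \<integral>\<^sub>m\<^sup>x 1/\<omega>\<close>.\<close>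

lemma modulus_function_integral_concave:
  assumes \<omega>: "modulus_function \<omega>" and m: "0 < m" "m \<le> x" "m \<le> y"
  shows "integral {m..y} (\<lambda>s. 1 / \<omega> s) - integral {m..x} (\<lambda>s. 1 / \<omega> s) \<le> (y - x) / \<omega> x"
proof (cases "x \<le> y")
  case True
  \<comment> \<open>The integrand is nonincreasing, so its value at \<open>x\<close> bounds it from
    above to the right of \<open>x\<close> and, in the other case, from below to the left.\<close>
  have "integral {x..y} (\<lambda>s. 1 / \<omega> s) \<le> integral {x..y} (\<lambda>s. 1 / \<omega> x)"
    using m True modulus_functionD[OF \<omega>]
    by (intro integral_le modulus_function_integrable[OF \<omega>]) (auto intro!: divide_left_mono mult_pos_pos)
  then show ?thesis
    using Henstock_Kurzweil_Integration.integral_combine[OF m(2) True modulus_function_integrable[OF \<omega> m(1)]] True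
    by simp
next
  case False
  have "integral {y..x} (\<lambda>s. 1 / \<omega> x) \<le> integral {y..x} (\<lambda>s. 1 / \<omega> s)"
    using m False modulus_functionD[OF \<omega>]
    by (intro integral_le modulus_function_integrable[OF \<omega>]) (auto intro!: divide_left_mono mult_pos_pos)
  then show ?thesis
    using Henstock_Kurzweil_Integration.integral_combine[OF m(3) _ modulus_function_integrable[OF \<omega> m(1)], of x] False
    by (simp add: diff_divide_distrib)
qed

text \<open>Composing \<open>g\<close> with the concave integral of \<open>1 / \<omega>\<close>
  cancels the factor \<open>\<omega> (g x)\<close> in the growth condition, by the tangent line
  inequality at \<open>g x\<close>. The error \<open>W\<close> is dominated by a monotone function
  of arbitrarily small increase, and the lower bound \<open>m\<close> keeps its weight at most
  \<open>1 / \<omega> m\<close>.\<close>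

lemma Osgood_comparison:
  fixes g \<xi> \<omega> :: "real \<Rightarrow> real" and W :: "real \<Rightarrow> real \<Rightarrow> real"
  assumes pq: "p \<le> q" and \<omega>: "modulus_function \<omega>" and \<xi>: "mono_on {p..q} \<xi>"
    and m: "0 < m" "\<And>t. t \<in> {p..q} \<Longrightarrow> m \<le> g t"
    and left: "\<And>x e. x \<in> {p<..q} \<Longrightarrow> e > 0 \<Longrightarrow> eventually (\<lambda>t. g x - e < g t) (at_left x)"
    and right: "\<And>x c. x \<in> {p..<q} \<Longrightarrow> \<omega> (g x) < c \<Longrightarrow>
      frequently (\<lambda>t. g t - g x \<le> c * (\<xi> t - \<xi> x) + W x t) (at_right x)"
    and error: "\<And>\<epsilon>. \<epsilon> > 0 \<Longrightarrow> \<exists>\<delta> V. (\<forall>x\<in>{p..q}. \<delta> x > 0) \<and> mono_on {p..q} V \<and> V q - V p \<le> \<epsilon> \<and>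
      (\<forall>x t. p \<le> x \<longrightarrow> x \<le> t \<longrightarrow> t \<le> q \<longrightarrow> t < x + \<delta> x \<longrightarrow> W x t \<le> V t - V x)"
  shows "integral {m..g q} (\<lambda>s. 1 / \<omega> s) - integral {m..g p} (\<lambda>s. 1 / \<omega> s) \<le> \<xi> q - \<xi> p"
proof -
  define h where "h t = integral {m..g t} (\<lambda>s. 1 / \<omega> s)" for t
  note \<omega>m = modulus_functionD(1)[OF \<omega> m(1)]
  have concave: "h t - h x \<le> (g t - g x) / \<omega> (g x)" if "x \<in> {p..q}" "t \<in> {p..q}" for x t
    unfolding h_def using modulus_function_integral_concave[OF \<omega> m(1)] m(2) that by blast
  have \<omega>g: "\<omega> m \<le> \<omega> (g x)" "0 < \<omega> (g x)" if "x \<in> {p..q}" for x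
    using modulus_functionD(2)[OF \<omega> m(1) m(2)[OF that]] \<omega>m by auto
  have approx: "h q - h p \<le> (1 + \<epsilon>) * (\<xi> q - \<xi> p) + \<epsilon> / \<omega> m" if \<epsilon>: "\<epsilon> > 0" for \<epsilon>
  proof -
    obtain \<delta> V where \<delta>: "\<And>x. x \<in> {p..q} \<Longrightarrow> \<delta> x > 0" and V: "mono_on {p..q} V" "V q - V p \<le> \<epsilon>"
      and WV: "\<And>x t. p \<le> x \<Longrightarrow> x \<le> t \<Longrightarrow> t \<le> q \<Longrightarrow> t < x + \<delta> x \<Longrightarrow> W x t \<le> V t - V x"
      using error[OF \<epsilon>] by blast
    \<comment> \<open>The factor \<open>1 + \<epsilon>\<close> supplies the strict inequality
      \<open>\<omega> (g x) < c\<close> that \<open>right\<close> demands; dividing \<open>V\<close>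
      by \<open>\<omega> m\<close> allows for every weight
      \<open>1 / \<omega> (g x)\<close>.\<close>
    define M where "M t = (1 + \<epsilon>) * \<xi> t + V t / \<omega> m" for t
    have "h q - h p \<le> M q - M p"
    proof (rule increment_le_monotone_increment[OF pq])
      show "mono_on {p..q} M"
        using \<epsilon> \<omega>m unfolding M_def
        by (auto intro!: mono_onI add_mono mult_left_mono divide_right_mono
            mono_onD[OF \<xi>] mono_onD[OF V(1)])
    next
      fix x e :: real assume x: "x \<in> {p<..q}" and e: "e > 0"
      have "eventually (\<lambda>t. t \<in> {p<..<x}) (at_left x)"
        using x by (intro eventually_at_left_real) auto
      moreover have "eventually (\<lambda>t. g x - e * \<omega> m < g t) (at_left x)"
        using left[OF x] e \<omega>m by simp
      ultimately show "eventually (\<lambda>t. h x - e < h t) (at_left x)"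
      proof eventually_elim
        case (elim t)
        then have t: "t \<in> {p..q}" using x by auto
        \<comment> \<open>Here the tangent is taken at \<open>g t\<close>, since an upper bound for
          \<open>h x - h t\<close> is wanted; its slope is at most \<open>1 / \<omega> m\<close>,
          which explains the margin \<open>e * \<omega> m\<close>.\<close>
        have "h x - h t \<le> (g x - g t) / \<omega> (g t)"
          using x t by (intro concave) auto
        also have "\<dots> < e"
        proof -
          have "g x - g t < e * \<omega> m" using elim by simp
          also have "\<dots> \<le> e * \<omega> (g t)" using \<omega>g[OF t] e by simp
          finally show ?thesis using \<omega>g[OF t] by (simp add: divide_less_eq)
        qed
        finally show ?case by simp
      qed
    next
      fix x assume x: "x \<in> {p..<q}"
      then have x': "x \<in> {p..q}" by simp
      have "\<omega> (g x) < (1 + \<epsilon>) * \<omega> (g x)"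
        using \<omega>g[OF x'] \<epsilon> by simp
      then have "frequently (\<lambda>t. g t - g x \<le> (1 + \<epsilon>) * \<omega> (g x) * (\<xi> t - \<xi> x) + W x t) (at_right x)"
        by (rule right[OF x])
      moreover have "eventually (\<lambda>t. t \<in> {x<..<min q (x + \<delta> x)}) (at_right x)"
        using x \<delta>[OF x'] by (intro eventually_at_right_real) auto
      ultimately obtain t where t: "t \<in> {x<..<min q (x + \<delta> x)}"
        and gt: "g t - g x \<le> (1 + \<epsilon>) * \<omega> (g x) * (\<xi> t - \<xi> x) + W x t"
        using frequently_ex[OF frequently_eventually_conj] by blast
      have t': "t \<in> {p..q}" using t x by auto
      have "W x t \<le> V t - V x" using WV t x by auto
      moreover have Vm: "V x \<le> V t" using t t' x' by (intro mono_onD[OF V(1)]) auto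
      ultimately have "(g t - g x) / \<omega> (g x) \<le>
          ((1 + \<epsilon>) * \<omega> (g x) * (\<xi> t - \<xi> x) + (V t - V x)) / \<omega> (g x)"
        using gt \<omega>g[OF x'] by (intro divide_right_mono) auto
      also have "\<dots> = (1 + \<epsilon>) * (\<xi> t - \<xi> x) + (V t - V x) / \<omega> (g x)"
        using \<omega>g(2)[OF x'] by (simp add: add_divide_distrib)
      also have "\<dots> \<le> (1 + \<epsilon>) * (\<xi> t - \<xi> x) + (V t - V x) / \<omega> m"
        using \<omega>g[OF x'] \<omega>m Vm by (intro add_left_mono divide_left_mono) auto
      also have "\<dots> = M t - M x"
        unfolding M_def by (simp add: algebra_simps diff_divide_distrib)
      finally have "(g t - g x) / \<omega> (g x) \<le> M t - M x" .
      then have "h t - h x \<le> M t - M x"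
        using concave[OF x' t'] by linarith
      then show "\<exists>t\<in>{x<..q}. h t - h x \<le> M t - M x"
        using t by (intro bexI[of _ t]) auto
    qed
    also have "M q - M p = (1 + \<epsilon>) * (\<xi> q - \<xi> p) + (V q - V p) / \<omega> m"
      unfolding M_def by (simp add: algebra_simps diff_divide_distrib)
    also have "\<dots> \<le> (1 + \<epsilon>) * (\<xi> q - \<xi> p) + \<epsilon> / \<omega> m"
      using V(2) \<omega>m by (intro add_left_mono divide_right_mono) auto
    finally show ?thesis .
  qed
  \<comment> \<open>Letting \<open>\<epsilon>\<close> tend to zero removes both the factor and the
    error term.\<close>
  have "((\<lambda>\<epsilon>. (1 + \<epsilon>) * (\<xi> q - \<xi> p) + \<epsilon> / \<omega> m) \<longlongrightarrow> (1 + 0) * (\<xi> q - \<xi> p) + 0 / \<omega> m) (at_right 0)"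
    using \<omega>m by (intro tendsto_intros) auto
  then have "h q - h p \<le> (1 + 0) * (\<xi> q - \<xi> p) + 0 / \<omega> m"
    by (rule tendsto_lowerbound)
      (auto intro: approx eventually_mono[OF eventually_at_right_less])
  then show ?thesis unfolding h_def by simp
qed

section \<open>Uniqueness of solutions on a compact interval\<close>

lemma frequently_less_of_Liminf_le:
  assumes "Liminf F (\<lambda>t. ereal (f t)) \<le> ereal c" "c < d"
  shows "frequently (\<lambda>t. f t < d) F"
proof (rule ccontr)
  assume "\<not> ?thesis"
  then have "eventually (\<lambda>t. ereal d \<le> ereal (f t)) F"
    by (simp add: not_frequently not_less)
  then have "ereal d \<le> Liminf F (\<lambda>t. ereal (f t))" by (rule Liminf_bounded)
  then have "ereal d \<le> ereal c" using assms(1) by (rule order_trans)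
  then show False using assms(2) by simp
qed

lemma zero_strong_HK_integral_subset:
  "zero_strong_HK_integral U I \<Longrightarrow> J \<subseteq> I \<Longrightarrow> zero_strong_HK_integral U J"
  unfolding zero_strong_HK_integral_def by (meson order_trans)

lemma solution_on_subset: "solution_on \<Omega> F I u \<Longrightarrow> J \<subseteq> I \<Longrightarrow> solution_on \<Omega> F J u"
  unfolding solution_on_def by (blast intro: zero_strong_HK_integral_subset)

lemma abs_dist_diff_le:
  fixes p q r s :: "'a::metric_space"
  shows "\<bar>dist p q - dist r s\<bar> \<le> dist p r + dist q s"
  by (smt (verit) dist_commute dist_triangle2 dist_triangle)

text \<open>Equality at the right endpoint suffices, since the lemma can be applied with any later
  time as \<open>\<beta>\<close>. Nothing is assumed at \<open>\<alpha>\<close> about the lower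
  limits, because \<open>\<alpha>\<close> may be the left end of the domain of
  \<open>F\<close>.\<close>

lemma solutions_eq:
  fixes \<Omega> :: "'a::metric_space set"
    and F :: "'a \<Rightarrow> real \<Rightarrow> real \<Rightarrow> 'a"
  assumes F_diag: "\<And>x \<tau>. x \<in> \<Omega> \<Longrightarrow> \<tau> \<in> {\<alpha>..\<beta>} \<Longrightarrow> F x \<tau> \<tau> = x"
    and left: "\<And>x y \<tau>. x \<in> \<Omega> \<Longrightarrow> y \<in> \<Omega> \<Longrightarrow> \<tau> \<in> {\<alpha><..\<beta>} \<Longrightarrow>
      Liminf (at_left \<tau>) (\<lambda>t. ereal (dist (F x \<tau> t) (F y \<tau> t) - dist x y)) \<ge> 0"
    and xi: "strict_mono_on {\<alpha>..\<beta>} \<xi>"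
    and omega: "Osgood_modulus_function \<omega>"
    and right: "\<And>x y \<tau>. x \<in> \<Omega> \<Longrightarrow> y \<in> \<Omega> \<Longrightarrow> \<tau> \<in> {\<alpha><..<\<beta>} \<Longrightarrow>
      Liminf (at_right \<tau>)
        (\<lambda>t. ereal ((dist (F x \<tau> t) (F y \<tau> t) - dist x y) / (\<xi> t - \<xi> \<tau>))) \<le> ereal (\<omega> (dist x y))"
    and u: "solution_on \<Omega> F {\<alpha>..\<beta>} u" and v: "solution_on \<Omega> F {\<alpha>..\<beta>} v"
    and init: "u \<alpha> = v \<alpha>" and "\<alpha> \<le> \<beta>"
  shows "u \<beta> = v \<beta>"
proof (rule ccontr)
  assume "u \<beta> \<noteq> v \<beta>"
  define g where "g t = dist (u t) (v t)" for t
  \<comment> \<open>\<open>D x\<close> follows the two \<open>F\<close>-curves issuing from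
    \<open>u x\<close> and \<open>v x\<close>, to which the hypotheses apply; \<open>W x\<close>
    bounds the cost of replacing the solutions by these curves.\<close>
  define D where "D x t = dist (F (u x) x t) (F (v x) x t)" for x t
  define W where "W x t = dist (u t) (F (u x) x t) + dist (v t) (F (v x) x t)" for x t
  have g\<beta>: "0 < g \<beta>" and g\<alpha>: "g \<alpha> = 0" using \<open>u \<beta> \<noteq> v \<beta>\<close> init by (auto simp: g_def)
  have mod: "modulus_function \<omega>" using omega by (simp add: Osgood_modulus_function_def)
  have \<Omega>: "u t \<in> \<Omega>" "v t \<in> \<Omega>" if "t \<in> {\<alpha>..\<beta>}" for t
    using u v that by (auto simp: solution_on_def)
  have HK: "zero_strong_HK_integral (\<lambda>x t. dist (u t) (F (u x) x t)) {\<alpha>..\<beta>}"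
    "zero_strong_HK_integral (\<lambda>x t. dist (v t) (F (v x) x t)) {\<alpha>..\<beta>}"
    using u v by (auto simp: solution_on_def)
  have gD: "\<bar>g t - D x t\<bar> \<le> W x t" for x t
    unfolding g_def D_def W_def by (rule abs_dist_diff_le)
  have Dgg: "D x x = g x" if "x \<in> {\<alpha>..\<beta>}" for x
    using F_diag \<Omega> that by (simp add: D_def g_def)
  have W0: "(W x \<longlongrightarrow> 0) (at x within {\<alpha>..\<beta>})" if x: "x \<in> {\<alpha>..\<beta>}" for x
  proof -
    have "(W x \<longlongrightarrow> 0 + 0) (at x within {\<alpha>..\<beta>})"
      unfolding W_def
      using F_diag[OF \<Omega>(1)[OF x] x] F_diag[OF \<Omega>(2)[OF x] x]
      by (intro tendsto_add zero_strong_HK_integral_tendsto[OF HK(1) order_refl x]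
          zero_strong_HK_integral_tendsto[OF HK(2) order_refl x]) auto
    then show ?thesis by simp
  qed
  have g_left: "eventually (\<lambda>t. g x - e < g t) (at_left x)" if x: "x \<in> {\<alpha><..\<beta>}" and "e > 0" for x e
  proof -
    have x': "x \<in> {\<alpha>..\<beta>}" using x by auto
    have "ereal (- (e / 2)) < 0" using \<open>e > 0\<close> by simp
    also have "0 \<le> Liminf (at_left x) (\<lambda>t. ereal (D x t - g x))"
      using left[OF \<Omega>[OF x'] x] unfolding D_def g_def .
    finally have "ereal (- (e / 2)) < Liminf (at_left x) (\<lambda>t. ereal (D x t - g x))" .
    then have "eventually (\<lambda>t. ereal (- (e / 2)) < ereal (D x t - g x)) (at_left x)"
      by (rule less_LiminfD)
    then have "eventually (\<lambda>t. - (e / 2) < D x t - g x) (at_left x)"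
      by (simp only: less_ereal.simps)
    moreover have "eventually (\<lambda>t. W x t < e / 2) (at_left x)"
    proof -
      have "at_left x = at x within {\<alpha>..x}"
        using x by (simp add: at_within_Icc_at_left)
      also have "\<dots> \<le> at x within {\<alpha>..\<beta>}"
        using x by (intro at_le) auto
      finally have "at_left x \<le> at x within {\<alpha>..\<beta>}" .
      then show ?thesis
        using order_tendstoD(2)[OF W0[OF x'], of "e / 2"] \<open>e > 0\<close> filter_leD by auto
    qed
    ultimately show ?thesis
    proof eventually_elim
      case (elim t)
      then show ?case using gD[of t x] by linarith
    qed
  qed
  have g_right: "frequently (\<lambda>t. g t - g x \<le> c * (\<xi> t - \<xi> x) + W x t) (at_right x)"
    if x: "x \<in> {\<alpha><..<\<beta>}" and c: "\<omega> (g x) < c" for x c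
  proof -
    have x': "x \<in> {\<alpha>..\<beta>}" using x by auto
    have "frequently (\<lambda>t. (D x t - g x) / (\<xi> t - \<xi> x) < c) (at_right x)"
      using right[OF \<Omega>[OF x'] x] c unfolding D_def g_def by (rule frequently_less_of_Liminf_le)
    moreover have "eventually (\<lambda>t. t \<in> {x<..<\<beta>}) (at_right x)"
      using x by (intro eventually_at_right_real) auto
    ultimately have "frequently (\<lambda>t. t \<in> {x<..<\<beta>} \<and> (D x t - g x) / (\<xi> t - \<xi> x) < c) (at_right x)"
      by (rule frequently_eventually_conj)
    then show ?thesis
    proof (rule frequently_elim1)
      fix t assume t: "t \<in> {x<..<\<beta>} \<and> (D x t - g x) / (\<xi> t - \<xi> x) < c"
      then have "\<xi> x < \<xi> t" using x by (intro strict_mono_onD[OF xi]) auto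
      then have "D x t - g x < c * (\<xi> t - \<xi> x)" using t by (simp add: divide_less_eq)
      then show "g t - g x \<le> c * (\<xi> t - \<xi> x) + W x t" using gD[of t x] by linarith
    qed
  qed
  have error: "\<exists>\<delta> V. (\<forall>x\<in>{p..\<beta>}. \<delta> x > 0) \<and> mono_on {p..\<beta>} V \<and> V \<beta> - V p \<le> \<epsilon> \<and>
      (\<forall>x t. p \<le> x \<longrightarrow> x \<le> t \<longrightarrow> t \<le> \<beta> \<longrightarrow> t < x + \<delta> x \<longrightarrow> W x t \<le> V t - V x)"
    if p: "\<alpha> \<le> p" "p \<le> \<beta>" and "\<epsilon> > 0" for p \<epsilon>
  proof -
    have sub: "{p..\<beta>} \<subseteq> {\<alpha>..\<beta>}" and \<epsilon>: "\<epsilon> / 2 > 0" using that by auto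
    obtain \<delta>1 V1 where 1: "\<And>z. z \<in> {p..\<beta>} \<Longrightarrow> \<delta>1 z > 0"
      "mono_on {p..\<beta>} V1" "V1 \<beta> - V1 p \<le> \<epsilon> / 2"
      "\<And>x y c. p \<le> x \<Longrightarrow> x \<le> c \<Longrightarrow> c \<le> y \<Longrightarrow> y \<le> \<beta> \<Longrightarrow> c - \<delta>1 c < x \<Longrightarrow> y < c + \<delta>1 c \<Longrightarrow>
       \<bar>dist (u y) (F (u c) c y) - dist (u x) (F (u c) c x)\<bar> \<le> V1 y - V1 x"
      using zero_strong_HK_integral_majorant[OF HK(1) p(2) sub \<epsilon>] by blast
    obtain \<delta>2 V2 where 2: "\<And>z. z \<in> {p..\<beta>} \<Longrightarrow> \<delta>2 z > 0"
      "mono_on {p..\<beta>} V2" "V2 \<beta> - V2 p \<le> \<epsilon> / 2"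
      "\<And>x y c. p \<le> x \<Longrightarrow> x \<le> c \<Longrightarrow> c \<le> y \<Longrightarrow> y \<le> \<beta> \<Longrightarrow> c - \<delta>2 c < x \<Longrightarrow> y < c + \<delta>2 c \<Longrightarrow>
       \<bar>dist (v y) (F (v c) c y) - dist (v x) (F (v c) c x)\<bar> \<le> V2 y - V2 x"
      using zero_strong_HK_integral_majorant[OF HK(2) p(2) sub \<epsilon>] by blast
    have "W x t \<le> (V1 t + V2 t) - (V1 x + V2 x)"
      if t: "p \<le> x" "x \<le> t" "t \<le> \<beta>" "t < x + min (\<delta>1 x) (\<delta>2 x)" for x t
    proof -
      have x: "x \<in> {\<alpha>..\<beta>}" "x \<in> {p..\<beta>}" using t p by auto
      \<comment> \<open>With the tag at the left endpoint \<open>x\<close>, the subtracted term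
        vanishes by \<open>F_diag\<close>, so the majorant bounds the distance itself.\<close>
      have "dist (u t) (F (u x) x t) \<le> V1 t - V1 x"
        using 1(4)[of x x t] 1(1)[OF x(2)] t F_diag[OF \<Omega>(1)[OF x(1)] x(1)] by simp
      moreover have "dist (v t) (F (v x) x t) \<le> V2 t - V2 x"
        using 2(4)[of x x t] 2(1)[OF x(2)] t F_diag[OF \<Omega>(2)[OF x(1)] x(1)] by simp
      ultimately show ?thesis by (simp add: W_def)
    qed
    then show ?thesis
      using 1(1,2,3) 2(1,2,3)
      by (intro exI[of _ "\<lambda>x. min (\<delta>1 x) (\<delta>2 x)"] exI[of _ "\<lambda>x. V1 x + V2 x"])
        (auto simp: mono_on_def intro!: add_mono)
  qed
  have bound: "integral {r..g \<beta>} (\<lambda>s. 1 / \<omega> s) \<le> \<xi> \<beta> - \<xi> \<alpha>" if r: "0 < r" "r < g \<beta>" for r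
  proof -
    define Z where "Z = {t \<in> {\<alpha>..\<beta>}. g t \<le> r}"
    define p where "p = Sup Z"
    have Z: "\<alpha> \<in> Z" "bdd_above Z" using g\<alpha> r \<open>\<alpha> \<le> \<beta>\<close> by (auto simp: Z_def)
    have p: "\<alpha> \<le> p" "p \<le> \<beta>"
      unfolding p_def using Z by (auto intro: cSup_upper intro!: cSup_least simp: Z_def)
    have above: "r < g t" if "p < t" "t \<le> \<beta>" for t
    proof (rule ccontr)
      assume "\<not> ?thesis"
      then have "t \<in> Z" using that p by (auto simp: Z_def)
      then show False using cSup_upper[OF _ Z(2), of t] that by (simp add: p_def)
    qed
    have gp: "g p \<le> r"
    proof (rule ccontr)
      assume ngp: "\<not> g p \<le> r"
      then have "\<alpha> < p" using p g\<alpha> r by (cases "\<alpha> = p") auto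
      then obtain l where l: "l < p" "\<And>t. l < t \<Longrightarrow> t < p \<Longrightarrow> r < g t"
        using g_left[of p "g p - r"] p ngp eventually_at_left[OF \<open>\<alpha> < p\<close>] by auto
      obtain t where t: "t \<in> Z" "l < t"
        using less_cSup_iff[OF _ Z(2), of l] l(1) Z(1) unfolding p_def by blast
      have "t \<le> p" unfolding p_def by (rule cSup_upper[OF t(1) Z(2)])
      then show False using l(2)[of t] t ngp by (cases "t = p") (auto simp: Z_def)
    qed
    then have "p < \<beta>" using p r by (cases "p = \<beta>") auto
    \<comment> \<open>If the solutions met at \<open>p\<close>, the two curves from there would
      coincide, giving \<open>g t \<le> W p t < r\<close> just after \<open>p\<close>, against
      \<open>above\<close>.\<close>
    have gp0: "0 < g p"
    proof (rule ccontr)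
      assume "\<not> ?thesis"
      then have eq: "u p = v p" by (simp add: g_def)
      have "at_right p \<le> at p within {\<alpha>..\<beta>}"
      proof -
        have "at_right p = at p within {p..\<beta>}"
          using \<open>p < \<beta>\<close> by (simp add: at_within_Icc_at_right)
        also have "\<dots> \<le> at p within {\<alpha>..\<beta>}" using p by (intro at_le) auto
        finally show ?thesis .
      qed
      then have "eventually (\<lambda>t. W p t < r) (at_right p)"
        using order_tendstoD(2)[OF W0, of p r] r p filter_leD by auto
      moreover have "eventually (\<lambda>t. t \<in> {p<..<\<beta>}) (at_right p)"
        using \<open>p < \<beta>\<close> by (rule eventually_at_right_real)
      ultimately have "eventually (\<lambda>t. False) (at_right p)"
      proof eventually_elim
        case (elim t)
        have "D p t = 0" by (simp add: D_def eq)
        then show ?case using elim above[of t] gD[of t p] by auto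
      qed
      then show False by simp
    qed
    \<comment> \<open>This makes \<open>p\<close> an interior point, so that \<open>g_right\<close>
      is available at \<open>p\<close> as well.\<close>
    then have "\<alpha> < p" using p g\<alpha> by (cases "\<alpha> = p") auto
    have sub: "{p..\<beta>} \<subseteq> {\<alpha>..\<beta>}" using p by auto
    have mono_xi: "mono_on {\<alpha>..\<beta>} \<xi>" using xi by (rule strict_mono_on_imp_mono_on)
    \<comment> \<open>The comparison runs with \<open>m = g p\<close>, so the second integral is
      over a single point and vanishes.\<close>
    have "integral {g p..g \<beta>} (\<lambda>s. 1 / \<omega> s) - integral {g p..g p} (\<lambda>s. 1 / \<omega> s) \<le> \<xi> \<beta> - \<xi> p"
    proof (rule Osgood_comparison[OF p(2) mod _ gp0])
      show "mono_on {p..\<beta>} \<xi>" using mono_xi sub by (rule mono_on_subset)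
      show "g p \<le> g t" if "t \<in> {p..\<beta>}" for t
        using above[of t] gp that by (cases "t = p") auto
      show "eventually (\<lambda>t. g x - e < g t) (at_left x)" if "x \<in> {p<..\<beta>}" "e > 0" for x e
        using g_left that p by auto
      show "frequently (\<lambda>t. g t - g x \<le> c * (\<xi> t - \<xi> x) + W x t) (at_right x)"
        if "x \<in> {p..<\<beta>}" "\<omega> (g x) < c" for x c
        using g_right that \<open>\<alpha> < p\<close> by auto
      show "\<exists>\<delta> V. (\<forall>x\<in>{p..\<beta>}. \<delta> x > 0) \<and> mono_on {p..\<beta>} V \<and> V \<beta> - V p \<le> \<epsilon> \<and>
        (\<forall>x t. p \<le> x \<longrightarrow> x \<le> t \<longrightarrow> t \<le> \<beta> \<longrightarrow> t < x + \<delta> x \<longrightarrow> W x t \<le> V t - V x)" if "\<epsilon> > 0" for \<epsilon>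
        using error[OF p that] .
    qed
    moreover have "integral {r..g \<beta>} (\<lambda>s. 1 / \<omega> s) \<le> integral {g p..g \<beta>} (\<lambda>s. 1 / \<omega> s)"
    proof (rule integral_subset_le)
      show "{r..g \<beta>} \<subseteq> {g p..g \<beta>}" using gp by auto
      show "\<forall>s\<in>{g p..g \<beta>}. 0 \<le> 1 / \<omega> s"
        using modulus_functionD(1)[OF mod] gp0 by (auto intro: less_imp_le)
    qed (use modulus_function_integrable[OF mod] r gp0 in auto)
    moreover have "\<xi> \<alpha> \<le> \<xi> p" using p by (intro mono_onD[OF mono_xi]) auto
    ultimately show ?thesis by simp
  qed
  \<comment> \<open>The bound just obtained does not depend on \<open>r\<close>, whereas the
    integral diverges as \<open>r\<close> tends to zero.\<close>
  have "filterlim (\<lambda>r. integral {r..g \<beta>} (\<lambda>s. 1 / \<omega> s)) at_top (at_right 0)"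
    using omega g\<beta> by (simp add: Osgood_modulus_function_def)
  then have "eventually (\<lambda>r. \<xi> \<beta> - \<xi> \<alpha> < integral {r..g \<beta>} (\<lambda>s. 1 / \<omega> s)) (at_right 0)"
    by (simp add: filterlim_at_top_dense)
  moreover have "eventually (\<lambda>r. r \<in> {0<..<g \<beta>}) (at_right 0)"
    using g\<beta> by (rule eventually_at_right_real)
  ultimately have "eventually (\<lambda>r::real. False) (at_right 0)"
  proof eventually_elim
    case (elim r)
    then show ?case using bound[of r] by auto
  qed
  then show False by simp
qed

theorem theorem5p3:
  fixes \<Omega> :: "'a::metric_space set"
    and F :: "'a \<Rightarrow> real \<Rightarrow> real \<Rightarrow> 'a"
    and a b :: real
    and \<xi> \<omega> :: "real \<Rightarrow> real"
    and u :: "real \<Rightarrow> 'a"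
  assumes F_diag: "\<And>x \<tau>. x \<in> \<Omega> \<Longrightarrow> \<tau> \<in> {a..<b} \<Longrightarrow> F x \<tau> \<tau> = x"
    and left: "\<And>x y \<tau>. x \<in> \<Omega> \<Longrightarrow> y \<in> \<Omega> \<Longrightarrow> \<tau> \<in> {a<..<b} \<Longrightarrow>
      Liminf (at_left \<tau>) (\<lambda>t. ereal (dist (F x \<tau> t) (F y \<tau> t) - dist x y)) \<ge> 0"
    and xi: "strict_mono_on {a..<b} \<xi>"
    and omega: "Osgood_modulus_function \<omega>"
    and right: "\<And>x y \<tau>. x \<in> \<Omega> \<Longrightarrow> y \<in> \<Omega> \<Longrightarrow> \<tau> \<in> {a<..<b} \<Longrightarrow>
      Liminf (at_right \<tau>)
        (\<lambda>t. ereal ((dist (F x \<tau> t) (F y \<tau> t) - dist x y) / (\<xi> t - \<xi> \<tau>))) \<le> ereal (\<omega> (dist x y))"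
    and sol: "solution_on \<Omega> F {a..<b} u"
  shows "\<forall>\<tau>\<in>{a..<b}. locally_unique_in_future \<Omega> F {a..<b} u (u \<tau>) \<tau>"
proof
  fix \<tau> assume \<tau>: "\<tau> \<in> {a..<b}"
  have sol_u: "\<exists>\<delta>>0. {\<tau>..\<tau> + \<delta>} \<subseteq> {a..<b} \<and> solution_on \<Omega> F {\<tau>..\<tau> + \<delta>} u"
  \<comment> \<open>Half of the remaining length keeps the closed interval away from the excluded
    endpoint \<open>b\<close>.\<close>
  proof (intro exI[of _ "(b - \<tau>) / 2"] conjI)
    show "0 < (b - \<tau>) / 2" using \<tau> by simp
    show sub: "{\<tau>..\<tau> + (b - \<tau>) / 2} \<subseteq> {a..<b}"
    proof
      fix t assume "t \<in> {\<tau>..\<tau> + (b - \<tau>) / 2}"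
      then have "\<tau> \<le> t" "t \<le> \<tau> + (b - \<tau>) / 2" by auto
      then show "t \<in> {a..<b}" using \<tau> by (simp add: field_simps)
    qed
    show "solution_on \<Omega> F {\<tau>..\<tau> + (b - \<tau>) / 2} u" by (rule solution_on_subset[OF sol sub])
  qed
  \<comment> \<open>Equality holds on the whole interval where \<open>v\<close> is a solution, so
    \<open>\<eta>\<close> itself serves as \<open>\<zeta>\<close>.\<close>
  have "v t = u t"
    if sub: "{\<tau>..\<tau> + \<eta>} \<subseteq> {a..<b}" and v: "solution_on \<Omega> F {\<tau>..\<tau> + \<eta>} v" and "v \<tau> = u \<tau>"
      and t: "t \<in> {\<tau>..\<tau> + \<eta>}" for v \<eta> t
  proof -
    have sub': "{\<tau>..t} \<subseteq> {\<tau>..\<tau> + \<eta>}" "{\<tau>..t} \<subseteq> {a..<b}"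
      using sub t by auto
    then have inner: "{\<tau><..t} \<subseteq> {a<..<b}" "{\<tau><..<t} \<subseteq> {a<..<b}"
      using \<tau> t by (auto simp: subset_eq)
    show ?thesis
    proof (rule solutions_eq[where \<alpha> = \<tau> and \<beta> = t and F = F and \<Omega> = \<Omega> and \<xi> = \<xi> and \<omega> = \<omega>])
      show "strict_mono_on {\<tau>..t} \<xi>" using xi sub'(2) by (rule monotone_on_subset)
      show "solution_on \<Omega> F {\<tau>..t} v" by (rule solution_on_subset[OF v sub'(1)])
      show "solution_on \<Omega> F {\<tau>..t} u" by (rule solution_on_subset[OF sol sub'(2)])
    qed (use F_diag left right omega sub' inner t \<open>v \<tau> = u \<tau>\<close> in auto)
  qed
  then show "locally_unique_in_future \<Omega> F {a..<b} u (u \<tau>) \<tau>"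
    unfolding locally_unique_in_future_def using sol_u by blast
qed

end
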